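(* Let $P=\frac12P_1+\frac12P_2$, where $P_1$ and $P_2$ are the uniform probability distributions on $[0,1]$ and $[\frac12,\frac32]$, respectively. The optimal set of four-means for $P$ is $\{0.198223,\ 0.59467,\ 0.90533,\ 1.30178\}$, with quantization error $V_4(P)=0.01057$, where all decimal values are understood as rounded to the displayed digits.
   Context: For a Borel probability measure $P$ on $\mathbb{R}$ and a nonempty finite $\alpha\subset\mathbb{R}$, put $V(P;\alpha)=\int\min_{a\in\alpha}(x-a)^2\,dP(x)$. The $n$th quantization error is $V_n(P)=\inf\{V(P;\alpha):\alpha\subset\mathbb{R},\ 1\le\mathrm{card}(\alpha)\le n\}$, and an optimal set of $n$-means is a set $\alpha$ with $1\le\mathrm{card}(\alpha)\le n$ and $V(P;\alpha)=V_n(P)$. The measure $P$ here has density $\frac12$ on $[0,\frac12]\cup[1,\frac32]$, $1$ on $[\frac12,1]$, and $0$ elsewhere. *)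

theory Defs
  imports "HOL-Analysis.Analysis"
begin

definition mixture :: "ennreal \<Rightarrow> 'a measure \<Rightarrow> ennreal \<Rightarrow> 'a measure \<Rightarrow> 'a measure" where
  "mixture p M q N =
     measure_of (space M) (sets M) (\<lambda>A. p * emeasure M A + q * emeasure N A)"

lemma sets_mixture [simp, measurable_cong]: "sets (mixture p M q N) = sets M"
  and space_mixture [simp]: "space (mixture p M q N) = space M"
  by (simp_all add: mixture_def)

lemma emeasure_mixture:
  assumes "sets N = sets M" "A \<in> sets M"
  shows "emeasure (mixture p M q N) A = p * emeasure M A + q * emeasure N A"
  unfolding mixture_def
proof (rule emeasure_measure_of_sigma)
  show "sigma_algebra (space M) (sets M)" ..
  show "positive (sets M) (\<lambda>A. p * emeasure M A + q * emeasure N A)"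
    by (simp add: positive_def)
  show "countably_additive (sets M) (\<lambda>A. p * emeasure M A + q * emeasure N A)"
  proof (rule countably_additiveI)
    fix F :: "nat \<Rightarrow> 'a set"
    assume F: "range F \<subseteq> sets M" "disjoint_family F"
    have "(\<Sum>i. emeasure M (F i)) = emeasure M (\<Union>i. F i)"
         "(\<Sum>i. emeasure N (F i)) = emeasure N (\<Union>i. F i)"
      using F assms(1) by (auto intro!: suminf_emeasure)
    then show "(\<Sum>i. p * emeasure M (F i) + q * emeasure N (F i)) =
        p * emeasure M (\<Union>i. F i) + q * emeasure N (\<Union>i. F i)"
      by (simp add: suminf_add[symmetric])
  qed
qed (use assms in simp)

lemma mixture_uniform_eq_density:
  "mixture (1/2) (uniform_measure lborel {0..1}) (1/2) (uniform_measure lborel {1/2..3/2}) =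
   density lborel (\<lambda>x::real. if 1/2 \<le> x \<and> x \<le> 1 then 1 else if 0 \<le> x \<and> x \<le> 3/2 then 1/2 else 0)"
  (is "?P = density lborel ?f")
proof (rule measure_eqI)
  show "sets ?P = sets (density lborel ?f)" by simp
next
  fix A assume "A \<in> sets ?P"
  then have [measurable]: "A \<in> sets borel" by simp
  have half: "(1::ennreal) = 1/2 + 1/2"
  proof -
    have "1/2 + 1/2 = (2::ennreal) * (1/2)" by (simp only: mult_2)
    also have "\<dots> = 1" by (simp add: ennreal_times_divide ennreal_divide_self)
    finally show ?thesis by simp
  qed
  have "emeasure ?P A = 1/2 * emeasure lborel ({0..1} \<inter> A) + 1/2 * emeasure lborel ({1/2..3/2} \<inter> A)"
    by (subst emeasure_mixture) (simp_all add: divide_ennreal_def)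
  also have "\<dots> = (\<integral>\<^sup>+x. 1/2 * indicator ({0..1} \<inter> A) x + 1/2 * indicator ({1/2..3/2} \<inter> A) x \<partial>lborel)"
    by (simp add: nn_integral_add nn_integral_cmult)
  also have "\<dots> = (\<integral>\<^sup>+x. ?f x * indicator A x \<partial>lborel)"
    by (intro nn_integral_cong) (auto simp: indicator_def half[symmetric])
  also have "\<dots> = emeasure (density lborel ?f) A"
    by (subst emeasure_density) simp_all
  finally show "emeasure ?P A = emeasure (density lborel ?f) A" .
qed

text \<open>The distortion is taken as a nonnegative integral, so that it is infinite rather
  than a spurious 0 when the integrand is not integrable.\<close>

definition distortion :: "real measure \<Rightarrow> real set \<Rightarrow> ennreal" where
  "distortion P \<alpha> = (\<integral>\<^sup>+x. ennreal (Min ((\<lambda>a. (x - a)\<^sup>2) ` \<alpha>)) \<partial>P)"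

definition quantization_error :: "nat \<Rightarrow> real measure \<Rightarrow> ennreal" where
  "quantization_error n P =
     Inf {distortion P \<alpha> | \<alpha>. finite \<alpha> \<and> 1 \<le> card \<alpha> \<and> card \<alpha> \<le> n}"

definition optimal_n_means :: "nat \<Rightarrow> real measure \<Rightarrow> real set \<Rightarrow> bool" where
  "optimal_n_means n P \<alpha> \<longleftrightarrow>
     finite \<alpha> \<and> 1 \<le> card \<alpha> \<and> card \<alpha> \<le> n \<and> distortion P \<alpha> = quantization_error n P"

definition round_dec :: "nat \<Rightarrow> real \<Rightarrow> real" where
  "round_dec k x = of_int (round (x * 10 ^ k)) / 10 ^ k"

end

theory Submission
  imports Defs
begin

text \<open>
  The measure has density 1/2 on \<open>[0, 3/2]\<close>, doubled on the core \<open>[1/2, 1]\<close>, and is symmetric about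
  3/4. For sorted points in \<open>[0, 3/2]\<close> the midpoints of neighbours cut the interval into four cells,
  and the distortion is the sum of the explicit piecewise cubic costs of these cells
  (\<open>distortion_sorted\<close>). Projecting points from outside onto \<open>[0, 3/2]\<close> does not increase it
  (\<open>distortion_clamp_le\<close>).

  The expected optimum is symmetric, so the boundary \<open>v\<close> between the second and third cell should be
  3/4. The optimal cost \<open>H(v)\<close> of covering \<open>[0, v]\<close> by two cells has derivative \<open>f(v) (v - a)^2\<close>,
  where \<open>f\<close> is the density and \<open>a\<close> the right-hand point; at \<open>v = 3/4\<close> this is
  \<open>inner_radius^2\<close>. The heart of the proof, \<open>two_cell_cost_ge\<close>, is that \<open>H\<close> lies above its
  tangent line, \<open>H(v) \<ge> half_error + inner_radius^2 (v - 3/4)\<close> for \<open>1/2 \<le> v \<le> 1\<close>. Adding this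
  inequality to its mirror image, where \<open>v\<close> becomes \<open>3/2 - v\<close>, cancels the linear terms and
  gives at least \<open>2 half_error\<close> in total. If \<open>v > 1\<close>, the two left cells cost at least as much as
  a covering of \<open>[0, 1]\<close>, which already exceeds \<open>2 half_error\<close>; \<open>v < 1/2\<close> is the mirror image.

  For the tangent line inequality itself, \<open>p^3\<close> lies above each of its tangent lines on
  \<open>p \<ge> 0\<close>, with difference \<open>(p - r)^2 (p + 2 r)\<close>. When the first cell ends in \<open>[0, 1/2]\<close>, the
  two-cell cost is a combination of cubes of the four half-widths and of one more cube,
  caused by the jump of the density at 1/2. Taking the tangents at the values of the expected
  optimum leaves an identity (\<open>two_cell_cost_identity\<close>) that displays the excess as a sum of
  terms which are nonnegative unless the second point is far left. The remaining configurations
  are far from optimal and coarse tangents suffice. Since each term contains the square of a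
  deviation from the optimum, the same identity yields uniqueness. The constants come from the
  centroid condition for the second cell: the first cell has the boundary \<open>b = (3 - sqrt 2) / 4\<close>,
  a root of \<open>16 b^2 - 24 b + 7\<close>, and the points are \<open>b/2\<close>, \<open>3 b/2\<close> and their mirror images.
\<close>

section \<open>Distortion as a sum of cell costs\<close>

definition dens :: "real \<Rightarrow> real" where
  "dens t = (if 1/2 \<le> t \<and> t \<le> 1 then 1 else if 0 \<le> t \<and> t \<le> 3/2 then 1/2 else 0)"

text \<open>Projection onto the interval \<open>[1/2, 1]\<close> of doubled density. It turns the integral of the
  extra density over a cell into a difference of cubes, wherever the cell lies.\<close>
definition core :: "real \<Rightarrow> real" where
  "core t = max (1/2) (min 1 t)"

text \<open>The integral of \<open>dens t * (t - a)^2\<close> over \<open>[u, v]\<close>: the first quotient comes from the density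
  1/2 on \<open>[0, 3/2]\<close>, the second from the additional 1/2 on the core.\<close>
definition cell_cost :: "real \<Rightarrow> real \<Rightarrow> real \<Rightarrow> real" where
  "cell_cost u v a = ((v - a)^3 - (u - a)^3) / 6 + ((core v - a)^3 - (core u - a)^3) / 6"

lemma has_integral_cell_cost:
  assumes "0 \<le> u" "u \<le> v" "v \<le> 3/2"
  shows "((\<lambda>t. dens t * (t - a)^2) has_integral cell_cost u v a) {u..v}"
proof -
  \<comment> \<open>An antiderivative off the two jumps of the density, and continuous across them.\<close>
  define A where "A = (\<lambda>t. (t - a)^3 / 6 + (core t - a)^3 / 6)"
  have "((\<lambda>t. dens t * (t - a)^2) has_integral (A v - A u)) {u..v}"
  proof (rule fundamental_theorem_of_calculus_interior_strong[where S = "{1/2, 1}"])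
    fix t assume t: "t \<in> {u<..<v} - {1/2, 1}"
    consider "t < 1/2" | "1/2 < t" "t < 1" | "1 < t" using t by force
    then have "(A has_real_derivative dens t * (t - a)^2) (at t)"
    proof cases
      case 1
      have "((\<lambda>t. (t - a)^3 / 6 + (1/2 - a)^3 / 6) has_real_derivative dens t * (t - a)^2) (at t)"
        using 1 t assms by (auto intro!: derivative_eq_intros simp: dens_def)
      then show ?thesis
        by (rule DERIV_cong_ev[THEN iffD1, rotated -1])
           (use 1 eventually_nhds_in_open[of "{..<1/2}" t] in
             \<open>auto elim!: eventually_mono simp: A_def core_def\<close>)
    next
      case 2
      have "((\<lambda>t. (t - a)^3 / 6 + (t - a)^3 / 6) has_real_derivative dens t * (t - a)^2) (at t)"
        using 2 t assms by (auto intro!: derivative_eq_intros simp: dens_def)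
      then show ?thesis
        by (rule DERIV_cong_ev[THEN iffD1, rotated -1])
           (use 2 eventually_nhds_in_open[of "{1/2<..<1}" t] in
             \<open>auto elim!: eventually_mono simp: A_def core_def\<close>)
    next
      case 3
      have "((\<lambda>t. (t - a)^3 / 6 + (1 - a)^3 / 6) has_real_derivative dens t * (t - a)^2) (at t)"
        using 3 t assms by (auto intro!: derivative_eq_intros simp: dens_def)
      then show ?thesis
        by (rule DERIV_cong_ev[THEN iffD1, rotated -1])
           (use 3 eventually_nhds_in_open[of "{1<..}" t] in
             \<open>auto elim!: eventually_mono simp: A_def core_def\<close>)
    qed
    then show "(A has_vector_derivative dens t * (t - a)^2) (at t)"
      by (simp add: has_real_derivative_iff_has_vector_derivative)
  next
    show "continuous_on {u..v} A"
      unfolding A_def core_def by (intro continuous_intros) auto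
  qed (use assms in auto)
  moreover have "A v - A u = cell_cost u v a"
    by (simp add: A_def cell_cost_def field_simps)
  ultimately show ?thesis by simp
qed

abbreviation \<mu> :: "real measure" where
  "\<mu> \<equiv> density lborel (\<lambda>x. ennreal (dens x))"

lemma mixture_eq_density_dens:
  "mixture (1/2) (uniform_measure lborel {0..1}) (1/2) (uniform_measure lborel {1/2..3/2}) =
   \<mu>"
proof -
  have "ennreal (1/2) = 1/2" by (metis ennreal_1 ennreal_divide_numeral zero_le_one)
  then have "(\<lambda>x. ennreal (dens x)) =
      (\<lambda>x. if 1/2 \<le> x \<and> x \<le> 1 then 1 else if 0 \<le> x \<and> x \<le> 3/2 then 1/2 else 0)"
    by (intro ext) (simp add: dens_def)
  then show ?thesis by (simp add: mixture_uniform_eq_density)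
qed

lemma dens_measurable [measurable]: "dens \<in> borel_measurable borel"
  unfolding dens_def by measurable

lemma Min_sq_measurable [measurable]:
  fixes \<alpha> :: "real set"
  assumes "finite \<alpha>"
  shows "(\<lambda>t. Min ((\<lambda>a. (t - a)^2) ` \<alpha>)) \<in> borel_measurable borel"
  using assms by measurable

lemma distortion_density:
  assumes "finite \<alpha>"
  shows "distortion \<mu> \<alpha> =
         (\<integral>\<^sup>+t. ennreal (dens t * Min ((\<lambda>a. (t - a)^2) ` \<alpha>)) \<partial>lborel)"
proof -
  note [measurable] = Min_sq_measurable[OF assms]
  show ?thesis unfolding distortion_def
    by (subst nn_integral_density)
       (auto intro!: nn_integral_cong simp: dens_def ennreal_mult')
qed

text \<open>Moving a point outside the support to the nearer end of \<open>[0, 3/2]\<close> brings it closer to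
  every point of the support.\<close>
lemma distortion_clamp_le:
  assumes "finite \<alpha>" "\<alpha> \<noteq> {}"
  shows "distortion \<mu> ((\<lambda>a. max 0 (min (3/2) a)) ` \<alpha>)
       \<le> distortion \<mu> \<alpha>"
proof -
  let ?k = "\<lambda>a::real. max 0 (min (3/2) a)"
  have *: "dens t * Min ((\<lambda>a. (t - a)^2) ` ?k ` \<alpha>) \<le> dens t * Min ((\<lambda>a. (t - a)^2) ` \<alpha>)" for t
  proof (cases "t \<in> {0..3/2}")
    case True
    have "Min ((\<lambda>a. (t - a)^2) ` ?k ` \<alpha>) \<le> (t - a)^2" if "a \<in> \<alpha>" for a
    proof -
      have "Min ((\<lambda>a. (t - a)^2) ` ?k ` \<alpha>) \<le> (t - ?k a)^2"
        using that assms by (intro Min_le) auto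
      also have "\<dots> \<le> (t - a)^2"
        using True by (intro abs_le_square_iff[THEN iffD1]) auto
      finally show ?thesis .
    qed
    then have "Min ((\<lambda>a. (t - a)^2) ` ?k ` \<alpha>) \<le> Min ((\<lambda>a. (t - a)^2) ` \<alpha>)"
      using assms by (subst Min_ge_iff) auto
    then show ?thesis by (intro mult_left_mono) (auto simp: dens_def)
  qed (auto simp: dens_def)
  show ?thesis using assms
    by (simp add: distortion_density) (intro nn_integral_mono ennreal_leI *)
qed

definition total_cost :: "real \<Rightarrow> real \<Rightarrow> real \<Rightarrow> real \<Rightarrow> real" where
  "total_cost x1 x2 x3 x4 =
     cell_cost 0 ((x1 + x2)/2) x1 + cell_cost ((x1 + x2)/2) ((x2 + x3)/2) x2 +
     cell_cost ((x2 + x3)/2) ((x3 + x4)/2) x3 + cell_cost ((x3 + x4)/2) (3/2) x4"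

lemma sq_dist_le_iff_midpoint:
  fixes x y t :: real
  assumes "x \<le> y"
  shows "t \<le> (x + y)/2 \<Longrightarrow> (t - x)^2 \<le> (t - y)^2"
    and "(x + y)/2 \<le> t \<Longrightarrow> (t - y)^2 \<le> (t - x)^2"
proof -
  have *: "(t - y)^2 - (t - x)^2 = 2 * (y - x) * ((x + y)/2 - t)"
    by (simp add: power2_eq_square field_simps)
  show "(t - x)^2 \<le> (t - y)^2" if "t \<le> (x + y)/2"
    using * that assms
    by (metis diff_ge_0_iff_ge mult_nonneg_nonneg zero_le_numeral)
  show "(t - y)^2 \<le> (t - x)^2" if "(x + y)/2 \<le> t"
    using * mult_nonneg_nonpos[of "2 * (y - x)" "(x + y)/2 - t"] that assms
    by (metis diff_ge_0_iff_ge diff_le_0_iff_le mult_nonneg_nonneg zero_le_numeral)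
qed

text \<open>Repeated points are allowed and produce empty cells, so that four arguments
  also describe sets with fewer elements.\<close>
lemma distortion_sorted:
  assumes x: "0 \<le> x1" "x1 \<le> x2" "x2 \<le> x3" "x3 \<le> x4" "x4 \<le> 3/2"
  shows "distortion \<mu> {x1, x2, x3, x4} =
         ennreal (total_cost x1 x2 x3 x4)"
proof -
  let ?\<alpha> = "{x1, x2, x3, x4}"
  let ?g = "\<lambda>t. dens t * Min ((\<lambda>a. (t - a)^2) ` ?\<alpha>)"
  have cell: "(?g has_integral cell_cost u v a) {u..v}"
    if uv: "0 \<le> u" "u \<le> v" "v \<le> 3/2" and a: "a \<in> ?\<alpha>"
      and near: "\<And>t b. t \<in> {u..v} \<Longrightarrow> b \<in> ?\<alpha> \<Longrightarrow> (t - a)^2 \<le> (t - b)^2" for u v a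
  proof (rule has_integral_eq[OF _ has_integral_cell_cost[OF uv]])
    fix t assume t: "t \<in> {u..v}"
    have "Min ((\<lambda>a. (t - a)^2) ` ?\<alpha>) = (t - a)^2"
      by (rule Min_eqI) (use near[OF t] a in blast)+
    then show "dens t * (t - a)^2 = ?g t" by simp
  qed
  note sq = sq_dist_le_iff_midpoint
  have "(?g has_integral total_cost x1 x2 x3 x4) {0..3/2}"
    unfolding total_cost_def
  proof (intro has_integral_combine[of 0 "(x3 + x4)/2" "3/2"]
      has_integral_combine[of 0 "(x2 + x3)/2" "(x3 + x4)/2"]
      has_integral_combine[of 0 "(x1 + x2)/2" "(x2 + x3)/2"] cell)
  qed (use x in \<open>auto intro: sq\<close>)
  then have "(?g has_integral total_cost x1 x2 x3 x4) UNIV"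
    by (rule has_integral_on_superset) (auto simp: dens_def)
  moreover have "0 \<le> ?g t" for t
    by (intro mult_nonneg_nonneg) (auto simp: dens_def Min_ge_iff)
  moreover have "?g \<in> borel_measurable borel"
    using Min_sq_measurable[of ?\<alpha>] by (intro borel_measurable_times) auto
  ultimately show ?thesis
    by (subst distortion_density) (auto intro!: nn_integral_has_integral_lborel)
qed

section \<open>Elementary properties of cell costs\<close>

lemma cube_tangent:
  fixes p r :: real
  assumes "0 \<le> p" "0 \<le> r"
  shows "p^3 \<ge> 3 * r^2 * p - 2 * r^3"
proof -
  have "p^3 - (3 * r^2 * p - 2 * r^3) = (p - r)^2 * (p + 2 * r)"
    by (simp add: power2_eq_square power3_eq_cube algebra_simps)
  then show ?thesis using assms
    by (metis add_nonneg_nonneg diff_ge_0_iff_ge mult_nonneg_nonneg zero_le_numeral zero_le_power2)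
qed

lemma cell_cost_reflect:
  "cell_cost (3/2 - v) (3/2 - u) (3/2 - a) = cell_cost u v a"
proof -
  have core: "core (3/2 - t) = 3/2 - core t" for t by (auto simp: core_def max_def min_def)
  have neg: "(3/2 - p - (3/2 - a))^3 = - ((p - a)^3)" for p :: real
    by (simp add: power3_eq_cube algebra_simps)
  show ?thesis unfolding cell_cost_def core neg by simp
qed

lemma cell_cost_split: "cell_cost u v a = cell_cost u w a + cell_cost w v a"
  by (simp add: cell_cost_def field_simps)

lemma core_mono: "u \<le> v \<Longrightarrow> core u \<le> core v"
  by (auto simp: core_def)

lemma cell_cost_nonneg: "u \<le> v \<Longrightarrow> 0 \<le> cell_cost u v a"
  unfolding cell_cost_def
  by (intro add_nonneg_nonneg divide_nonneg_nonneg)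
     (auto simp: core_mono intro!: power_mono_odd)

text \<open>If the point of a cell ending at 1 lies to the right of 1, moving it to 1 helps. This keeps the
  point inside the cell when the cell is cut off at 1.\<close>
lemma cell_cost_clip:
  assumes "u \<le> 1" "1 \<le> a"
  shows "cell_cost u 1 1 \<le> cell_cost u 1 a"
proof -
  have *: "(1 - 1)^3 - (p - 1)^3 \<le> (1 - a)^3 - (p - a)^3" if "p \<le> 1" for p :: real
  proof -
    have "((1 - a)^3 - (p - a)^3) - ((1 - 1)^3 - (p - 1)^3) = 3 * ((1 - p) * (a - 1) * (a - p))"
      by (simp add: power3_eq_cube algebra_simps)
    moreover have "0 \<le> (1 - p) * (a - 1) * (a - p)" using that assms by auto
    ultimately show ?thesis by argo
  qed
  have "core 1 = 1" "core u \<le> 1" using assms by (auto simp: core_def)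
  then show ?thesis unfolding cell_cost_def
    using *[of u] *[of "core u"] assms
    by (metis (no_types, lifting) add_mono divide_right_mono zero_le_numeral)
qed

section \<open>Two cells covering a left segment\<close>

text \<open>At the optimum, \<open>outer_radius\<close> is the distance from the first point to both ends of its cell and
  from the second point to the left end of its cell, and \<open>inner_radius\<close> is the distance from the
  second point to 3/4.\<close>
definition outer_radius :: real where "outer_radius = (3 - sqrt 2) / 8"
definition inner_radius :: real where "inner_radius = 3 * (sqrt 2 - 1) / 8"
definition half_error :: real where "half_error = (19 - 12 * sqrt 2) / 384"

lemma sqrt2_bounds: "1.41421356 < sqrt 2" "sqrt 2 < 1.41421357"
  by (rule real_less_rsqrt real_less_lsqrt; simp add: power2_eq_square)+

text \<open>The first four terms on the right are the gaps between cubes of half-widths and their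
  tangents. The last is the gap between \<open>(x2 - 1/2)^3 / 6\<close> and its tangent at \<open>x2 = 3 outer_radius\<close>,
  the effect of the jump at 1/2; there the linear terms in \<open>x2\<close> balance exactly because
  \<open>3 outer_radius\<close> is the centroid of the optimal second cell.\<close>
lemma two_cell_cost_identity:
  assumes "u \<le> 1/2" "1/2 \<le> v" "v \<le> 1"
  shows "cell_cost 0 u x1 + cell_cost u v x2 - (half_error + inner_radius^2 * (v - 3/4)) =
     ((x1 - outer_radius)^2 * (x1 + 2 * outer_radius)
       + (u - x1 - outer_radius)^2 * (u - x1 + 2 * outer_radius)
       + (x2 - u - outer_radius)^2 * (x2 - u + 2 * outer_radius)) / 6
     + (v - x2 - inner_radius)^2 * (v - x2 + 2 * inner_radius) / 3
     + (x2 - 3 * outer_radius)^2 * (x2 - 2 * inner_radius) / 6"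
proof -
  have c: "core 0 = 1/2" "core u = 1/2" "core v = v" using assms by (auto simp: core_def)
  define s where "s = sqrt 2"
  have s: "s^2 = 2" by (simp add: s_def)
  have ss: "s * s = 2" using s by (simp add: power2_eq_square)
  have ss': "s * (s * z) = 2 * z" for z using ss by (simp add: mult.assoc[symmetric])
  show ?thesis
    unfolding cell_cost_def c outer_radius_def inner_radius_def half_error_def s_def[symmetric]
    by (simp add: power2_eq_square power3_eq_cube field_simps ss ss')
qed

text \<open>The coarse estimates away from the optimum have slack, so these few digits suffice there.\<close>
lemma radius_bounds:
    "198/1000 < outer_radius" "outer_radius < 199/1000"
    "1553/10000 < inner_radius" "inner_radius < 1554/10000"
    "2412/100000 < inner_radius^2" "inner_radius^2 < 2414/100000"
    "528/100000 < half_error" "half_error < 529/100000"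
proof -
  have "inner_radius^2 = 9 * (3 - 2 * sqrt 2) / 64"
    by (simp add: inner_radius_def power2_eq_square field_simps)
  then show "2412/100000 < inner_radius^2" "inner_radius^2 < 2414/100000"
    using sqrt2_bounds by simp_all
qed (use sqrt2_bounds in \<open>simp_all add: outer_radius_def inner_radius_def half_error_def\<close>)

text \<open>The minimal cost of two cells covering \<open>[0, v]\<close>, as a function of \<open>v\<close>, lies above its tangent
  line at \<open>v = 3/4\<close>. The common boundary \<open>u\<close> is free rather than the midpoint of \<open>x1\<close> and \<open>x2\<close>,
  because the inequality is also applied to cells that have been cut off.\<close>
lemma two_cell_cost_ge:
  assumes x: "0 \<le> x1" "x1 \<le> u" "u \<le> x2" "x2 \<le> v" and v: "1/2 \<le> v" "v \<le> 1"
  defines "C \<equiv> cell_cost 0 u x1 + cell_cost u v x2"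
    and "B \<equiv> half_error + inner_radius^2 * (v - 3/4)"
  shows "B \<le> C" and "C = B \<Longrightarrow> x1 = outer_radius \<and> x2 = 3 * outer_radius"
proof -
  note rb = radius_bounds
  have core: "core 0 = 1/2" "core v = v" using v by (auto simp: core_def)
  have "B < C \<or> (B \<le> C \<and> (C = B \<longrightarrow> x1 = outer_radius \<and> x2 = 3 * outer_radius))"
  proof (cases "u \<le> 1/2")
    case True
    have cu: "core u = 1/2" using True by (auto simp: core_def)
    show ?thesis
    proof (cases "2 * inner_radius \<le> x2")
      case x2: True
      have pos: "0 < x1 + 2 * outer_radius" "0 < u - x1 + 2 * outer_radius" "0 < x2 - u + 2 * outer_radius"
        "0 < v - x2 + 2 * inner_radius" "0 \<le> x2 - 2 * inner_radius"
        using x x2 rb by auto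
      note nn = mult_nonneg_nonneg[OF zero_le_power2[of "x1 - outer_radius"] less_imp_le[OF pos(1)]]
        mult_nonneg_nonneg[OF zero_le_power2[of "u - x1 - outer_radius"] less_imp_le[OF pos(2)]]
        mult_nonneg_nonneg[OF zero_le_power2[of "x2 - u - outer_radius"] less_imp_le[OF pos(3)]]
        mult_nonneg_nonneg[OF zero_le_power2[of "v - x2 - inner_radius"] less_imp_le[OF pos(4)]]
        mult_nonneg_nonneg[OF zero_le_power2[of "x2 - 3 * outer_radius"] pos(5)]
      note id = two_cell_cost_identity[OF True v, of x1 x2, folded C_def B_def]
      have "B \<le> C" using id nn by argo
      moreover have "x1 = outer_radius \<and> x2 = 3 * outer_radius" if "C = B"
      proof -
        have "(x1 - outer_radius)^2 * (x1 + 2 * outer_radius) = 0"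
          "(u - x1 - outer_radius)^2 * (u - x1 + 2 * outer_radius) = 0"
          "(x2 - u - outer_radius)^2 * (x2 - u + 2 * outer_radius) = 0"
          using id nn that by argo+
        then have "x1 - outer_radius = 0" "u - x1 - outer_radius = 0" "x2 - u - outer_radius = 0"
          using pos unfolding mult_eq_0_iff power_eq_0_iff by argo+
        then show ?thesis by argo
      qed
      ultimately show ?thesis by blast
    next
      case False
      \<comment> \<open>The part of the second cell to the right of \<open>x2\<close> is already too expensive. The tangent is taken near
        \<open>p = sqrt 2 * inner_radius\<close>, where \<open>p^3 / 6 - inner_radius^2 * p\<close> is smallest.\<close>
      have p3: "3 * (22/100)^2 * (v - x2) - 2 * (22/100)^3 \<le> (v - x2)^3"
        by (rule cube_tangent) (use x in auto)
      have "0 \<le> cell_cost 0 u x1" using x by (intro cell_cost_nonneg) auto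
      moreover have "(1/2 - x2)^3 \<le> (v - x2)^3" using v by (intro power_mono_odd) auto
      moreover have "0 \<le> (x2 - u)^3" using x by simp
      moreover have "(u - x2)^3 = - ((x2 - u)^3)" by (simp add: power3_eq_cube algebra_simps)
      ultimately have "C \<ge> (v - x2)^3 / 6"
        unfolding C_def cell_cost_def core cu by argo
      moreover have "inner_radius^2 * (v - x2) \<le> 242/10000 * (v - x2)"
        by (rule mult_right_mono) (use rb x in auto)
      moreover have "inner_radius^2 * (x2 - 3/4) \<le> 2412/100000 * (x2 - 3/4)"
        by (rule mult_right_mono_neg) (use rb False in auto)
      moreover have "B = half_error + inner_radius^2 * (v - x2) + inner_radius^2 * (x2 - 3/4)"
        by (simp add: B_def algebra_simps)
      moreover have "1452/10000 * (v - x2) - 21296/1000000 \<le> (v - x2)^3"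
        using p3 by (simp add: power_divide)
      moreover have "x2 < 3108/10000" using rb False by simp
      ultimately have "B < C"
        using rb(7,8) by (simp add: field_simps del: power_Suc)
      then show ?thesis ..
    qed
  next
    case False
    have cu: "core u = u" using False x v by (auto simp: core_def)
    \<comment> \<open>The first cell reaches into the core. Its cost is estimated with density 1/2 only, by tangents at
      1/4, which fit the extreme case \<open>u = 1/2\<close>; in the second cell, tangents at \<open>inner_radius\<close>
      produce the slope of the claimed line in \<open>v\<close>.\<close>
    have t: "3 * (1/4)^2 * x1 - 2 * (1/4)^3 \<le> x1^3"
      "3 * (1/4)^2 * (u - x1) - 2 * (1/4)^3 \<le> (u - x1)^3"
      "3 * inner_radius^2 * (v - x2) - 2 * inner_radius^3 \<le> (v - x2)^3"
      "3 * inner_radius^2 * (x2 - u) - 2 * inner_radius^3 \<le> (x2 - u)^3"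
      by (rule cube_tangent; use x rb in simp)+
    have "(1/2 - x1)^3 \<le> (u - x1)^3" using False by (intro power_mono_odd) auto
    moreover have "(u - x2)^3 = - ((x2 - u)^3)" "(0 - x1)^3 = - (x1^3)"
      by (simp_all add: power3_eq_cube algebra_simps)
    ultimately have "C \<ge> (x1^3 + (u - x1)^3) / 6 + ((v - x2)^3 + (x2 - u)^3) / 3"
      unfolding C_def cell_cost_def core cu by argo
    then have C: "C \<ge> u / 32 - 1/96 + inner_radius^2 * v - inner_radius^2 * u - 4 * inner_radius^3 / 3"
      using t by (simp add: power_divide field_simps)
    define kv ku k where k: "kv = inner_radius^2 * v" "ku = inner_radius^2 * u" "k = inner_radius^2"
    have "ku \<le> 2414/100000 * u"
      unfolding k by (rule mult_right_mono) (use rb x in auto)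
    moreover have "inner_radius^3 \<le> 1554/10000 * k"
      using mult_right_mono[of inner_radius "1554/10000" "inner_radius^2"] rb
      by (simp add: k power2_eq_square power3_eq_cube)
    moreover have "B = half_error + kv - 3/4 * k"
      by (simp add: B_def k algebra_simps)
    ultimately have "B < C" using C[folded k(1,2)] rb(5-8)[folded k(3)] False by linarith
    then show ?thesis ..
  qed
  then show "B \<le> C" "C = B \<Longrightarrow> x1 = outer_radius \<and> x2 = 3 * outer_radius" by auto
qed

text \<open>Cutting the cells off at 1 lowers the cost, and the tangent line at \<open>v = 1\<close> has the value
  \<open>half_error + inner_radius^2 / 4\<close>, which is larger than \<open>2 * half_error\<close>.\<close>
lemma two_cell_cost_gt_of_long:
  assumes x: "0 \<le> x1" "x1 \<le> u" "u \<le> x2" "x2 \<le> v" and v: "1 < v"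
  shows "2 * half_error < cell_cost 0 u x1 + cell_cost u v x2"
proof -
  have big: "2 * half_error < half_error + inner_radius^2 * (1 - 3/4)" using radius_bounds by simp
  show ?thesis
  proof (cases "u \<le> 1")
    case True
    have "half_error + inner_radius^2 * (1 - 3/4) \<le> cell_cost 0 u x1 + cell_cost u 1 (min x2 1)"
      by (rule two_cell_cost_ge) (use x True in auto)
    moreover have "cell_cost u 1 (min x2 1) \<le> cell_cost u 1 x2"
      using cell_cost_clip[OF True, of x2] by (cases "x2 \<le> 1") auto
    moreover have "0 \<le> cell_cost 1 v x2" using v by (intro cell_cost_nonneg) auto
    ultimately show ?thesis using big cell_cost_split[of u v x2 1] by linarith
  next
    case False
    \<comment> \<open>The first cell alone covers \<open>[0, 1]\<close>; the second is taken as the degenerate cell \<open>[1, 1]\<close>.\<close>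
    have "half_error + inner_radius^2 * (1 - 3/4) \<le> cell_cost 0 1 (min x1 1) + cell_cost 1 1 1"
      by (rule two_cell_cost_ge) (use x in auto)
    moreover have "cell_cost 1 1 1 = 0" by (simp add: cell_cost_def)
    moreover have "cell_cost 0 1 (min x1 1) \<le> cell_cost 0 1 x1"
      using cell_cost_clip[of 0 x1] by (cases "x1 \<le> 1") auto
    moreover have "0 \<le> cell_cost 1 u x1" "0 \<le> cell_cost u v x2"
      using x False by (auto intro!: cell_cost_nonneg)
    ultimately show ?thesis using big cell_cost_split[of 0 u x1 1] by linarith
  qed
qed

section \<open>Four cells\<close>

lemma total_cost_ge:
  assumes x: "0 \<le> x1" "x1 \<le> x2" "x2 \<le> x3" "x3 \<le> x4" "x4 \<le> 3/2"
  shows "2 * half_error \<le> total_cost x1 x2 x3 x4"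
    and "total_cost x1 x2 x3 x4 = 2 * half_error \<Longrightarrow>
           x1 = outer_radius \<and> x2 = 3 * outer_radius \<and>
           x3 = 3/2 - 3 * outer_radius \<and> x4 = 3/2 - outer_radius"
proof -
  define m where "m = (x2 + x3) / 2"
  define L where "L = cell_cost 0 ((x1 + x2)/2) x1 + cell_cost ((x1 + x2)/2) m x2"
  \<comment> \<open>The right half, reflected at 3/4 so that it also starts at 0.\<close>
  define R where "R = cell_cost 0 (3/2 - (x3 + x4)/2) (3/2 - x4)
      + cell_cost (3/2 - (x3 + x4)/2) (3/2 - m) (3/2 - x3)"
  have T: "total_cost x1 x2 x3 x4 = L + R"
    using cell_cost_reflect[of "3/2" "(x3 + x4)/2" x4] cell_cost_reflect[of "(x3 + x4)/2" m x3]
    by (simp add: total_cost_def L_def R_def m_def)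
  have nn: "0 \<le> L" "0 \<le> R" unfolding L_def R_def m_def using x
    by (auto intro!: add_nonneg_nonneg cell_cost_nonneg)
  have oL: "0 \<le> x1" "x1 \<le> (x1 + x2)/2" "(x1 + x2)/2 \<le> x2" "x2 \<le> m"
    and oR: "0 \<le> 3/2 - x4" "3/2 - x4 \<le> 3/2 - (x3 + x4)/2" "3/2 - (x3 + x4)/2 \<le> 3/2 - x3"
      "3/2 - x3 \<le> 3/2 - m"
    using x by (auto simp: m_def)
  have "2 * half_error \<le> L + R \<and> (L + R = 2 * half_error \<longrightarrow>
      x1 = outer_radius \<and> x2 = 3 * outer_radius \<and>
           x3 = 3/2 - 3 * outer_radius \<and> x4 = 3/2 - outer_radius)"
  proof -
    consider "1 < m" | "m < 1/2" | "1/2 \<le> m" "m \<le> 1" by linarith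
    then show ?thesis
    proof cases
      case 1
      then show ?thesis using two_cell_cost_gt_of_long[OF oL] nn unfolding L_def by linarith
    next
      case 2
      then show ?thesis using two_cell_cost_gt_of_long[OF oR] nn unfolding R_def by linarith
    next
      case 3
      have m': "1/2 \<le> 3/2 - m" "3/2 - m \<le> 1" using 3 by auto
      note l = two_cell_cost_ge[OF oL 3, folded L_def]
      note r = two_cell_cost_ge[OF oR m', folded R_def]
      define d where "d = inner_radius^2 * (m - 3/4)"
      have d': "inner_radius^2 * (3/2 - m - 3/4) = - d" by (simp add: d_def algebra_simps)
      have ge: "half_error + d \<le> L" "half_error - d \<le> R"
        using l(1) r(1) unfolding d' d_def by simp_all
      have "2 * half_error \<le> L + R" using ge by linarith
      moreover have "L = half_error + inner_radius^2 * (m - 3/4)"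
        "R = half_error + inner_radius^2 * (3/2 - m - 3/4)" if "L + R = 2 * half_error"
        using ge that unfolding d' d_def[symmetric] by linarith+
      then have "x1 = outer_radius \<and> x2 = 3 * outer_radius \<and>
          3/2 - x4 = outer_radius \<and> 3/2 - x3 = 3 * outer_radius"
        if "L + R = 2 * half_error"
        using l(2) r(2) that by blast
      ultimately show ?thesis by auto
    qed
  qed
  then show "2 * half_error \<le> total_cost x1 x2 x3 x4"
    "total_cost x1 x2 x3 x4 = 2 * half_error \<Longrightarrow>
       x1 = outer_radius \<and> x2 = 3 * outer_radius \<and>
           x3 = 3/2 - 3 * outer_radius \<and> x4 = 3/2 - outer_radius"
    using T by auto
qed

lemma total_cost_optimum:
  "total_cost outer_radius (3 * outer_radius) (3/2 - 3 * outer_radius) (3/2 - outer_radius)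
     = 2 * half_error"
proof -
  have u: "(outer_radius + 3 * outer_radius) / 2 = 2 * outer_radius"
    and m: "(3 * outer_radius + (3/2 - 3 * outer_radius)) / 2 = 3/4"
    and w: "((3/2 - 3 * outer_radius) + (3/2 - outer_radius)) / 2 = 3/2 - 2 * outer_radius"
    by (simp_all add: field_simps)
  have "3/4 - 3 * outer_radius - inner_radius = 0"
    by (simp add: outer_radius_def inner_radius_def field_simps)
  then have "cell_cost 0 (2 * outer_radius) outer_radius
      + cell_cost (2 * outer_radius) (3/4) (3 * outer_radius) = half_error"
    using two_cell_cost_identity[of "2 * outer_radius" "3/4" outer_radius "3 * outer_radius"] radius_bounds by simp
  moreover have "cell_cost (3/2 - 2 * outer_radius) (3/2) (3/2 - outer_radius)
      = cell_cost 0 (2 * outer_radius) outer_radius"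
    "cell_cost (3/4) (3/2 - 2 * outer_radius) (3/2 - 3 * outer_radius)
      = cell_cost (2 * outer_radius) (3/4) (3 * outer_radius)"
    using cell_cost_reflect[of "2 * outer_radius" 0 outer_radius]
      cell_cost_reflect[of "3/4" "2 * outer_radius" "3 * outer_radius"] by simp_all
  ultimately show ?thesis unfolding total_cost_def u m w by linarith
qed

section \<open>Optimal sets\<close>

text \<open>A set with fewer than four elements is listed with its maximum repeated.\<close>
lemma sorted_four:
  fixes \<alpha> :: "real set"
  assumes "finite \<alpha>" "1 \<le> card \<alpha>" "card \<alpha> \<le> 4"
  obtains x1 x2 x3 x4 where "x1 \<le> x2" "x2 \<le> x3" "x3 \<le> x4" "\<alpha> = {x1, x2, x3, x4}"
proof -
  define xs where "xs = sorted_list_of_set \<alpha>"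
  have xs: "sorted xs" "set xs = \<alpha>" "length xs = card \<alpha>"
    using assms by (auto simp: xs_def)
  define y where "y i = xs ! min i (length xs - 1)" for i
  have ne: "0 < length xs" using xs assms by simp
  have lt: "min i (length xs - 1) < length xs" for i using ne by linarith
  have mono: "y i \<le> y j" if "i \<le> j" for i j
    unfolding y_def using that lt by (intro sorted_nth_mono[OF xs(1)]) (auto simp: min_def)
  have "\<alpha> = y ` {..<4}"
  proof
    show "y ` {..<4} \<subseteq> \<alpha>" unfolding y_def xs(2)[symmetric] using lt by (auto intro!: nth_mem)
    show "\<alpha> \<subseteq> y ` {..<4}"
    proof
      fix a assume "a \<in> \<alpha>"
      then obtain i where "i < length xs" "a = xs ! i"
        unfolding xs(2)[symmetric] by (auto simp: in_set_conv_nth)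
      then have "a = y i" "i < 4" using xs(3) assms by (auto simp: y_def min_def)
      then show "a \<in> y ` {..<4}" by auto
    qed
  qed
  also have "{..<4} = {0, 1, 2, 3::nat}" by auto
  finally have "\<alpha> = {y 0, y 1, y 2, y 3}" by simp
  then show thesis by (rule that[rotated -1]) (auto intro: mono)
qed

abbreviation optimum :: "real set" where
  "optimum \<equiv> {outer_radius, 3 * outer_radius, 3/2 - 3 * outer_radius, 3/2 - outer_radius}"

lemma distortion_optimum: "distortion \<mu> optimum = ennreal (2 * half_error)"
  using distortion_sorted[of outer_radius "3 * outer_radius" "3/2 - 3 * outer_radius" "3/2 - outer_radius"]
    radius_bounds(1,2) total_cost_optimum by simp

text \<open>The points are first projected onto \<open>[0, 3/2]\<close>, where the cost formula holds.\<close>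
lemma distortion_ge:
  assumes \<alpha>: "finite \<alpha>" "1 \<le> card \<alpha>" "card \<alpha> \<le> 4"
  shows "ennreal (2 * half_error) \<le> distortion \<mu> \<alpha>"
    and "distortion \<mu> \<alpha> = ennreal (2 * half_error) \<Longrightarrow> \<alpha> = optimum"
proof -
  define k where "k = (\<lambda>a::real. max 0 (min (3/2) a))"
  obtain x1 x2 x3 x4 where x: "x1 \<le> x2" "x2 \<le> x3" "x3 \<le> x4" "\<alpha> = {x1, x2, x3, x4}"
    using sorted_four[OF \<alpha>] .
  have mono: "k a \<le> k b" if "a \<le> b" for a b using that by (auto simp: k_def)
  have k: "0 \<le> k x1" "k x1 \<le> k x2" "k x2 \<le> k x3" "k x3 \<le> k x4" "k x4 \<le> 3/2"
    using mono x(1-3) by (simp_all add: k_def)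
  have "ennreal (total_cost (k x1) (k x2) (k x3) (k x4)) = distortion \<mu> (k ` \<alpha>)"
    using distortion_sorted[OF k] x(4) by simp
  also have "\<dots> \<le> distortion \<mu> \<alpha>"
    unfolding k_def by (rule distortion_clamp_le) (use x(4) in auto)
  finally have le: "ennreal (total_cost (k x1) (k x2) (k x3) (k x4)) \<le> distortion \<mu> \<alpha>" .
  show "ennreal (2 * half_error) \<le> distortion \<mu> \<alpha>"
    using total_cost_ge(1)[OF k] le by (meson ennreal_leI order_trans)
  assume "distortion \<mu> \<alpha> = ennreal (2 * half_error)"
  then have "total_cost (k x1) (k x2) (k x3) (k x4) = 2 * half_error"
    using le total_cost_ge(1)[OF k] radius_bounds(7)
    by (intro antisym) (simp_all add: ennreal_le_iff)
  then have "k x1 = outer_radius \<and> k x2 = 3 * outer_radius \<and>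
      k x3 = 3/2 - 3 * outer_radius \<and> k x4 = 3/2 - outer_radius"
    by (rule total_cost_ge(2)[OF k])
  \<comment> \<open>The optimal points are interior to \<open>[0, 3/2]\<close>, so none of them can result from a proper projection.\<close>
  moreover have interior: "a = c" if "k a = c" "0 < c" "c < 3/2" for a c
    using that by (auto simp: k_def max_def min_def split: if_splits)
  moreover have "0 < outer_radius" "3 * outer_radius < 3/2" using radius_bounds(1,2) by simp_all
  ultimately have "x1 = outer_radius" "x2 = 3 * outer_radius" "x3 = 3/2 - 3 * outer_radius"
    "x4 = 3/2 - outer_radius"
    using interior[of x1 outer_radius] interior[of x2 "3 * outer_radius"]
      interior[of x3 "3/2 - 3 * outer_radius"] interior[of x4 "3/2 - outer_radius"] by auto
  then show "\<alpha> = optimum" using x(4) by simp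
qed

lemma round_dec_eqI:
  assumes "\<bar>x * 10 ^ k - of_int n\<bar> < 1/2"
  shows "round_dec k x = of_int n / 10 ^ k"
  unfolding round_dec_def using round_unique'[OF assms] by simp

theorem proposition3p4:
  fixes P P1 P2 :: "real measure"
  assumes P1: "P1 = uniform_measure lborel {0..1}"
    and P2: "P2 = uniform_measure lborel {1/2..3/2}"
    and P: "P = mixture (1/2) P1 (1/2) P2"
  shows "(\<exists>a1 a2 a3 a4.
            {\<alpha>. optimal_n_means 4 P \<alpha>} = {{a1, a2, a3, a4}} \<and>
            round_dec 6 a1 = 0.198223 \<and> round_dec 5 a2 = 0.59467 \<and>
            round_dec 5 a3 = 0.90533 \<and> round_dec 5 a4 = 1.30178) \<and>
         quantization_error 4 P < \<infinity> \<and>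
         round_dec 5 (enn2real (quantization_error 4 P)) = 0.01057"
proof -
  have P: "P = \<mu>" unfolding P P1 P2 by (rule mixture_eq_density_dens)
  have card: "card optimum \<le> 4" "1 \<le> card optimum"
    using card_length[of "[outer_radius, 3 * outer_radius, 3/2 - 3 * outer_radius, 3/2 - outer_radius]"]
    by (auto simp: Suc_le_eq card_gt_0_iff)
  have Q: "quantization_error 4 P = ennreal (2 * half_error)"
    unfolding quantization_error_def P
  proof (rule antisym)
    show "Inf {distortion \<mu> \<alpha> |\<alpha>. finite \<alpha> \<and> 1 \<le> card \<alpha> \<and> card \<alpha> \<le> 4} \<le> ennreal (2 * half_error)"
      by (rule Inf_lower) (use distortion_optimum card in \<open>force intro: exI[of _ optimum]\<close>)
    show "ennreal (2 * half_error) \<le> Inf {distortion \<mu> \<alpha> |\<alpha>. finite \<alpha> \<and> 1 \<le> card \<alpha> \<and> card \<alpha> \<le> 4}"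
      by (rule Inf_greatest) (auto intro: distortion_ge(1))
  qed
  have "{\<alpha>. optimal_n_means 4 P \<alpha>} = {optimum}"
  proof (intro equalityI subsetI)
    fix \<alpha> assume "\<alpha> \<in> {\<alpha>. optimal_n_means 4 P \<alpha>}"
    then show "\<alpha> \<in> {optimum}"
      using distortion_ge(2)[of \<alpha>] Q by (simp add: optimal_n_means_def P)
  next
    fix \<alpha> assume "\<alpha> \<in> {optimum}"
    then have "\<alpha> = optimum" by simp
    then show "\<alpha> \<in> {\<alpha>. optimal_n_means 4 P \<alpha>}"
      unfolding mem_Collect_eq optimal_n_means_def Q
      using card distortion_optimum P by simp
  qed
  moreover have "round_dec 6 outer_radius = 0.198223" "round_dec 5 (3 * outer_radius) = 0.59467"
    "round_dec 5 (3/2 - 3 * outer_radius) = 0.90533" "round_dec 5 (3/2 - outer_radius) = 1.30178"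
    "round_dec 5 (2 * half_error) = 0.01057"
    using sqrt2_bounds
      round_dec_eqI[of outer_radius 6 198223] round_dec_eqI[of "3 * outer_radius" 5 59467]
      round_dec_eqI[of "3/2 - 3 * outer_radius" 5 90533] round_dec_eqI[of "3/2 - outer_radius" 5 130178]
      round_dec_eqI[of "2 * half_error" 5 1057]
    by (simp_all add: abs_less_iff outer_radius_def half_error_def)
  moreover have "enn2real (quantization_error 4 P) = 2 * half_error" "quantization_error 4 P < \<infinity>"
    using Q radius_bounds by simp_all
  ultimately show ?thesis by metis
qed

end
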